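(* For any $n,k\ge 1$ (and any $p$), $\mathcal{O}(2n,p,k)=\Omega\big(k^{-1}\mathcal{S}(n,p,k-1)\big)$.
   Context: For a directed graph $G=(V,E)$ and $\mathcal{P}\subseteq V\times V$, a subgraph $H$ of $G$ is a $k$-fault-tolerant reachability subgraph of $G$ for $\mathcal{P}$ if for every $(s,t)\in\mathcal{P}$ and every $F\subseteq E$ with $|F|\le k$, $t$ is reachable from $s$ in $G\setminus F$ iff in $H\setminus F$ (for $k=0$ this is an ordinary reachability preserver). A $k$-fault-tolerant reachability oracle of $G$ for $\mathcal{P}$ is a data structure that, given $(s,t)\in\mathcal{P}$ and $F\subseteq E$ with $|F|\le k$, decides whether $t$ is reachable from $s$ in $G\setminus F$. $\mathcal{S}(n,p,k)$ denotes the extremal size (number of edges) of $k$-fault-tolerant reachability subgraphs over $n$-vertex directed graphs with $|\mathcal{P}|=p$ demand pairs, i.e. the maximum over such $(G,\mathcal{P})$ of the minimum size of a $k$-fault-tolerant reachability subgraph; $\mathcal{O}(n,p,k)$ denotes the analogous extremal size (in bits) of $k$-fault-tolerant reachability oracles. *)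

theory Defs
  imports Complex_Main "Graph_Theory.Graph_Theory"
begin

definition delete_arcs :: "'a pair_pre_digraph \<Rightarrow> ('a \<times> 'a) set \<Rightarrow> 'a pair_pre_digraph" where
  "delete_arcs G F = G \<lparr> parcs := parcs G - F \<rparr>"

definition reachable_avoiding ::
  "'a pair_pre_digraph \<Rightarrow> ('a \<times> 'a) set \<Rightarrow> 'a \<Rightarrow> 'a \<Rightarrow> bool" where
  "reachable_avoiding G F s t \<longleftrightarrow> s \<rightarrow>\<^sup>*\<^bsub>with_proj (delete_arcs G F)\<^esub> t"

definition ft_reachability_subgraph ::
  "nat \<Rightarrow> 'a pair_pre_digraph \<Rightarrow> ('a \<times> 'a) set \<Rightarrow> 'a pair_pre_digraph \<Rightarrow> bool" where
  "ft_reachability_subgraph k G P H \<longleftrightarrow>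
     subgraph (with_proj H) (with_proj G) \<and>
     (\<forall>(s, t) \<in> P. \<forall>F \<subseteq> parcs G. card F \<le> k \<longrightarrow>
        (reachable_avoiding G F s t \<longleftrightarrow> reachable_avoiding H F s t))"

text \<open>The \<open>n\<close>-vertex directed graphs are represented on the standard vertex set
  \<open>{..<n}\<close>. They have no parallel arcs; loops are allowed.\<close>

definition instances :: "nat \<Rightarrow> nat \<Rightarrow> (nat pair_pre_digraph \<times> (nat \<times> nat) set) set" where
  "instances n p = {(G, P). pair_fin_digraph G \<and> pverts G = {..<n} \<and>
     P \<subseteq> pverts G \<times> pverts G \<and> card P = p}"

definition min_ft_subgraph_size :: "nat \<Rightarrow> 'a pair_pre_digraph \<Rightarrow> ('a \<times> 'a) set \<Rightarrow> nat" where
  "min_ft_subgraph_size k G P =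
     (LEAST m. \<exists>H. ft_reachability_subgraph k G P H \<and> card (parcs H) = m)"

text \<open>There are only finitely many instances for given \<open>n\<close> and \<open>p\<close>, so the supremum below is a
  maximum. If \<open>p > n\<^sup>2\<close> there are none, and the supremum is \<open>0\<close>.\<close>

definition ft_subgraph_extremal :: "nat \<Rightarrow> nat \<Rightarrow> nat \<Rightarrow> nat" where
  "ft_subgraph_extremal n p k = (SUP (G, P) \<in> instances n p. min_ft_subgraph_size k G P)"

text \<open>\<open>answers k G P q\<close>: the answers given by \<open>q\<close> to the admissible queries \<open>((s, t), F)\<close> are
  those required of a \<open>k\<close>-fault-tolerant reachability oracle of \<open>G\<close> for \<open>P\<close>. Nothing is
  required for other queries.\<close>

definition answers ::
  "nat \<Rightarrow> 'a pair_pre_digraph \<Rightarrow> ('a \<times> 'a) set \<Rightarrow>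
   ('a \<times> 'a \<Rightarrow> ('a \<times> 'a) set \<Rightarrow> bool) \<Rightarrow> bool" where
  "answers k G P q \<longleftrightarrow>
     (\<forall>(s, t) \<in> P. \<forall>F \<subseteq> parcs G. card F \<le> k \<longrightarrow>
        (q (s, t) F \<longleftrightarrow> reachable_avoiding G F s t))"

text \<open>A data structure is a preprocessing map, storing an instance as a bit string, together
  with a query procedure. The query procedure sees the graph only through the stored bit string:
  if it could depend on the instance, no bits at all would be needed. It may depend on \<open>n\<close>, \<open>p\<close>
  and \<open>k\<close>, and its computation is unrestricted.\<close>

definition ft_reachability_oracle ::
  "nat \<Rightarrow> nat \<Rightarrow> nat \<Rightarrow> (nat pair_pre_digraph \<times> (nat \<times> nat) set \<Rightarrow> bool list) \<Rightarrow>
   (bool list \<Rightarrow> nat \<times> nat \<Rightarrow> (nat \<times> nat) set \<Rightarrow> bool) \<Rightarrow> bool" where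
  "ft_reachability_oracle n p k store query \<longleftrightarrow>
     (\<forall>(G, P) \<in> instances n p. answers k G P (query (store (G, P))))"

text \<open>The size of an oracle is the number of bits stored on a worst-case instance.\<close>

definition ft_oracle_extremal :: "nat \<Rightarrow> nat \<Rightarrow> nat \<Rightarrow> nat" where
  "ft_oracle_extremal n p k =
     (LEAST b. \<exists>store query. ft_reachability_oracle n p k store query \<and>
        (SUP I \<in> instances n p. length (store I)) = b)"

text \<open>The following facts show that the minima and suprema above are attained.\<close>

lemma finite_instances: "finite (instances n p)"
proof (rule finite_subset)
  let ?V = "{..<n} \<times> {..<n}"
  let ?g = "\<lambda>E. \<lparr> pverts = {..<n}, parcs = E \<rparr>"
  show "instances n p \<subseteq> (?g ` Pow ?V) \<times> Pow ?V"
  proof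
    fix I assume "I \<in> instances n p"
    then obtain G P where I: "I = (G, P)" and G: "pair_fin_digraph G" "pverts G = {..<n}"
      and P: "P \<subseteq> ?V"
      by (auto simp: instances_def)
    have "parcs G \<subseteq> ?V"
      using G pair_wf_digraph.in_arcsD1[of G] pair_wf_digraph.in_arcsD2[of G]
      by (auto simp: pair_fin_digraph_def)
    moreover have "G = ?g (parcs G)"
      using G by simp
    ultimately show "I \<in> (?g ` Pow ?V) \<times> Pow ?V"
      using I P by blast
  qed
qed simp

lemma ft_reachability_subgraph_refl:
  assumes "pair_wf_digraph G"
  shows "ft_reachability_subgraph k G P G"
proof -
  interpret pair_wf_digraph G by fact
  show ?thesis
    unfolding ft_reachability_subgraph_def subgraph_def compatible_def
    using wf_digraph_axioms by auto
qed

lemma ft_reachability_oracle_exists: "\<exists>store query. ft_reachability_oracle n p k store query"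
proof -
  obtain c :: "nat pair_pre_digraph \<times> (nat \<times> nat) set \<Rightarrow> nat" where c: "inj_on c (instances n p)"
    using finite_imp_inj_to_nat_seg[OF finite_instances[of n p]] by metis
  let ?store = "\<lambda>I. replicate (c I) True"
  let ?dec = "\<lambda>w. inv_into (instances n p) c (length w)"
  let ?query = "\<lambda>w (s, t) F. reachable_avoiding (fst (?dec w)) F s t"
  have "ft_reachability_oracle n p k ?store ?query"
    using c by (auto simp: ft_reachability_oracle_def answers_def)
  then show ?thesis by blast
qed

end

(* Let H be a smallest (k-1)-fault-tolerant reachability subgraph. Each arc e of H is critical: some
   demand (s, t) and some F_e of size at most k - 1 are such that t is reachable from s in H - F_e, but
   not in H - F_e - e. The relation "f is in F_e" has out-degree at most k - 1, so H has a set Y of at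
   least |H| / (2 k - 1) arcs with F_e disjoint from Y for all e in Y. Add a copy v' of each vertex v,
   with an arc (v', v), and for a subset X of Y let G_X consist of H, these arcs, and a detour
   u -> v' -> v around each arc (u, v) in X. For e in Y, the failure of F_e together with e, at most k
   arcs, leaves t reachable from s in G_X exactly if e is in X. So an oracle stores different bit
   strings for the 2^|Y| subsets X of Y, and one of them has at least |Y| bits. *)

theory Submission
  imports Defs
begin

section \<open>Independent sets in digraphs of bounded out-degree\<close>

text \<open>Read \<open>f v\<close> as the set of out-neighbours of \<open>v\<close>. In-degrees and
  out-degrees within \<open>V\<close> have the same sum, so some vertex has in-degree at most
  \<open>d\<close>. The greedy choice takes such a vertex, discards its neighbours and recurses. The
  \<open>{v}\<close> on the right allows for loops.\<close>

lemma exists_independent_subset: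
  assumes "finite V" "\<And>v. v \<in> V \<Longrightarrow> finite (f v)" "\<And>v. v \<in> V \<Longrightarrow> card (f v) \<le> d"
  shows "\<exists>Y \<subseteq> V. (\<forall>v \<in> Y. f v \<inter> Y \<subseteq> {v}) \<and> card V \<le> (2 * d + 1) * card Y"
  using assms
proof (induction V rule: finite_psubset_induct)
  case (psubset V)
  show ?case
  proof (cases "V = {}")
    case False
    let ?pred = "\<lambda>v. {w \<in> V. v \<in> f w}"
    have "\<exists>v \<in> V. card (?pred v) \<le> d"
    proof (rule ccontr)
      assume "\<not> ?thesis"
      then have "(\<Sum>v \<in> V. d) < (\<Sum>v \<in> V. card (?pred v))"
        using psubset.hyps False by (intro sum_strict_mono) auto
      also have "\<dots> = (\<Sum>w \<in> V. card {v \<in> V. v \<in> f w})"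
        using psubset.hyps by (intro sum_multicount_gen) auto
      also have "\<dots> \<le> (\<Sum>w \<in> V. d)"
      proof (rule sum_mono)
        fix w assume "w \<in> V"
        then have "card {v \<in> V. v \<in> f w} \<le> card (f w)"
          using psubset.prems(1) by (intro card_mono) auto
        then show "card {v \<in> V. v \<in> f w} \<le> d"
          using psubset.prems(2)[OF \<open>w \<in> V\<close>] by simp
      qed
      finally show False by simp
    qed
    then obtain v where v: "v \<in> V" "card (?pred v) \<le> d" by blast
    \<comment> \<open>Discarding neighbours in both directions keeps \<open>v\<close> independent of
      all later choices. Each chosen vertex costs at most \<open>1 + d + d\<close> vertices of
      \<open>V\<close>.\<close>
    let ?N = "insert v (f v \<union> ?pred v)"
    have fin: "finite ?N" using psubset v by auto
    have "card ?N \<le> Suc (card (f v \<union> ?pred v))" by (rule card_insert_le_m1) auto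
    also have "\<dots> \<le> Suc (card (f v) + card (?pred v))" using card_Un_le by auto
    also have "\<dots> \<le> 2 * d + 1" using v psubset.prems(2)[OF v(1)] by simp
    finally have N: "card ?N \<le> 2 * d + 1" .
    have "V - ?N \<subset> V" using v by blast
    then have "\<exists>Y \<subseteq> V - ?N. (\<forall>w \<in> Y. f w \<inter> Y \<subseteq> {w}) \<and> card (V - ?N) \<le> (2 * d + 1) * card Y"
      by (rule psubset.IH) (use psubset.prems in blast)+
    then obtain Y where Y: "Y \<subseteq> V - ?N"
      "\<forall>w \<in> Y. f w \<inter> Y \<subseteq> {w}" "card (V - ?N) \<le> (2 * d + 1) * card Y"
      by blast
    have finY: "finite Y" and "v \<notin> Y" using Y(1) psubset.hyps finite_subset by auto
    have "card V \<le> card (V - ?N) + card ?N"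
      using diff_card_le_card_Diff[OF fin, of V] by linarith
    also have "\<dots> \<le> (2 * d + 1) * card (insert v Y)"
      using Y(3) N finY \<open>v \<notin> Y\<close> by (simp add: algebra_simps)
    finally have "card V \<le> (2 * d + 1) * card (insert v Y)" .
    moreover have "\<forall>w \<in> insert v Y. f w \<inter> insert v Y \<subseteq> {w}"
      using Y(1,2) by blast
    moreover have "insert v Y \<subseteq> V" using Y(1) v(1) by blast
    ultimately show ?thesis by blast
  qed simp
qed

section \<open>Critical arcs of a minimum fault-tolerant subgraph\<close>

text \<open>Allows reasoning with plain \<open>rtrancl\<close>. The condition on \<open>s\<close>
  remains because \<open>rtrancl\<close> is reflexive everywhere, but reachability only on
  vertices.\<close>

lemma reachable_avoiding_iff:
  assumes "pair_wf_digraph G"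
  shows "reachable_avoiding G F s t \<longleftrightarrow> s \<in> pverts G \<and> (s, t) \<in> (parcs G - F)\<^sup>*"
proof
  assume "reachable_avoiding G F s t"
  then show "s \<in> pverts G \<and> (s, t) \<in> (parcs G - F)\<^sup>*"
    by (auto simp: reachable_avoiding_def reachable_def delete_arcs_def
        dest: in_rtrancl_on_in_F rtrancl_on_rtranclI)
next
  assume r: "s \<in> pverts G \<and> (s, t) \<in> (parcs G - F)\<^sup>*"
  have wf: "b \<in> pverts G" if "(a, b) \<in> parcs G - F" for a b
    using pair_wf_digraph.in_arcsD2[OF assms] that by blast
  from r have "(s, t) \<in> (parcs G - F)\<^sup>*" "s \<in> pverts G" by auto
  then have "t \<in> pverts G" by (induction rule: rtrancl_induct) (auto intro: wf)
  with r wf show "reachable_avoiding G F s t"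
    by (auto simp: reachable_avoiding_def reachable_def delete_arcs_def
        intro: rtrancl_consistent_rtrancl_on)
qed

text \<open>By minimality, \<open>H\<close> without \<open>e\<close> answers some query wrongly.
  Since \<open>H\<close> answers it like \<open>G\<close> and deleting an arc never creates
  reachability, the walk exists in \<open>H\<close> and is lost with \<open>e\<close>.\<close>

lemma minimal_ft_subgraph_critical_arc:
  assumes G: "pair_fin_digraph G"
    and H: "ft_reachability_subgraph k G P H" "card (parcs H) = min_ft_subgraph_size k G P"
    and e: "e \<in> parcs H"
  shows "\<exists>s t F. (s, t) \<in> P \<and> F \<subseteq> parcs H \<and> card F \<le> k \<and> s \<in> pverts H \<and>
    (s, t) \<in> (parcs H - F)\<^sup>* \<and> (s, t) \<notin> (parcs H - insert e F)\<^sup>*"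
proof -
  let ?H' = "H\<lparr>parcs := parcs H - {e}\<rparr>"
  have finG: "finite (parcs G)" using G by (simp add: pair_fin_digraph.pair_finite_arcs)
  have sub: "parcs H \<subseteq> parcs G" "subgraph (with_proj H) (with_proj G)"
    using H(1) by (auto simp: ft_reachability_subgraph_def subgraph_def)
  have wf: "pair_wf_digraph H"
    using sub(2) by (simp add: subgraph_def wf_digraph_wp_iff)
  then have wf': "pair_wf_digraph ?H'" by (auto simp: pair_wf_digraph_def)
  have sub': "subgraph (with_proj ?H') (with_proj G)"
    using sub wf' by (auto simp: subgraph_def wf_digraph_wp_iff compatible_def)
  have "card (parcs ?H') < card (parcs H)"
    using card_Diff1_less[OF finite_subset[OF sub(1) finG] e] by simp
  moreover have "min_ft_subgraph_size k G P \<le> card (parcs ?H')"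
    if "ft_reachability_subgraph k G P ?H'"
    unfolding min_ft_subgraph_size_def using that by (intro Least_le) blast
  ultimately have "\<not> ft_reachability_subgraph k G P ?H'"
    using H(2) by linarith
  then obtain s t F where st: "(s, t) \<in> P" and F: "F \<subseteq> parcs G" "card F \<le> k"
    and ne: "reachable_avoiding G F s t \<noteq> reachable_avoiding ?H' F s t"
    using sub' by (auto simp: ft_reachability_subgraph_def)
  have "reachable_avoiding G F s t = reachable_avoiding H F s t"
    using H(1) st F by (auto simp: ft_reachability_subgraph_def)
  moreover have "reachable_avoiding H F s t" if "reachable_avoiding ?H' F s t"
    using that wf wf' rtrancl_mono[of "parcs H - {e} - F" "parcs H - F"]
    by (auto simp: reachable_avoiding_iff)
  ultimately have "reachable_avoiding H F s t" "\<not> reachable_avoiding ?H' F s t"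
    using ne by auto
  then have r: "s \<in> pverts H" "(s, t) \<in> (parcs H - F)\<^sup>*" "(s, t) \<notin> (parcs H - {e} - F)\<^sup>*"
    using wf wf' by (auto simp: reachable_avoiding_iff)
  \<comment> \<open>Failures outside \<open>H\<close> do not affect walks in \<open>H\<close>.
    Cutting \<open>F\<close> down to arcs of \<open>H\<close> makes it an admissible failure set in
    every detour digraph built on \<open>H\<close>.\<close>
  have "parcs H - F = parcs H - (F \<inter> parcs H)"
    "parcs H - {e} - F = parcs H - insert e (F \<inter> parcs H)" by auto
  moreover have "card (F \<inter> parcs H) \<le> k"
    using F finite_subset[OF F(1) finG] card_mono[of F "F \<inter> parcs H"] by auto
  ultimately show ?thesis
    using st r by (intro exI[of _ s] exI[of _ t] exI[of _ "F \<inter> parcs H"]) simp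
qed

section \<open>Detours that encode a set of arcs\<close>

text \<open>The copy of \<open>v\<close> is \<open>v + n\<close>. The return arcs
  \<open>(v + n, v)\<close> are present for every \<open>v\<close>, so \<open>X\<close> is encoded
  only by the arcs entering the copies.\<close>

definition detour_digraph :: "nat \<Rightarrow> (nat \<times> nat) set \<Rightarrow> (nat \<times> nat) set \<Rightarrow> nat pair_pre_digraph" where
  "detour_digraph n E X = \<lparr>pverts = {..<2 * n},
     parcs = E \<union> (\<lambda>v. (v + n, v)) ` {..<n} \<union> (\<lambda>(u, v). (u, v + n)) ` X\<rparr>"

lemma pair_fin_digraph_detour:
  assumes "E \<subseteq> {..<n} \<times> {..<n}" "X \<subseteq> E"
  shows "pair_fin_digraph (detour_digraph n E X)"
proof
  have "E \<subseteq> {..<2 * n} \<times> {..<2 * n}" using assms(1) by auto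
  moreover have "(u, v + n) \<in> {..<2 * n} \<times> {..<2 * n}" if "(u, v) \<in> X" for u v
    using that assms by auto
  ultimately have sub: "parcs (detour_digraph n E X) \<subseteq> {..<2 * n} \<times> {..<2 * n}"
    by (auto simp: detour_digraph_def)
  then show "finite (parcs (detour_digraph n E X))"
    by (rule finite_subset) simp
  show "fst e \<in> pverts (detour_digraph n E X)" "snd e \<in> pverts (detour_digraph n E X)"
    if "e \<in> parcs (detour_digraph n E X)" for e
    using subsetD[OF sub that] by (auto simp: detour_digraph_def)
qed (simp add: detour_digraph_def)

text \<open>If \<open>e\<close> is in \<open>X\<close>, its detour replaces it on a walk avoiding
  \<open>F\<close>. Otherwise the remaining detours run parallel to arcs that have not failed, so
  they add no reachability between original vertices.\<close>

lemma detour_reachable_iff: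
  assumes E: "E \<subseteq> {..<n} \<times> {..<n}" and X: "X \<subseteq> E" and F: "F \<subseteq> E" "F \<inter> X \<subseteq> {e}"
    and e: "e \<in> E"
    and s: "s < n" and t: "t < n"
    and crit: "(s, t) \<in> (E - F)\<^sup>*" "(s, t) \<notin> (E - insert e F)\<^sup>*"
  shows "reachable_avoiding (detour_digraph n E X) (insert e F) s t \<longleftrightarrow> e \<in> X"
proof -
  let ?D = "detour_digraph n E X"
  let ?R = "parcs ?D - insert e F"
  have "pair_wf_digraph ?D"
    using pair_fin_digraph_detour[OF E X] by (simp add: pair_fin_digraph_def)
  then have iff: "reachable_avoiding ?D (insert e F) s t \<longleftrightarrow> (s, t) \<in> ?R\<^sup>*"
    using s by (simp add: reachable_avoiding_iff detour_digraph_def)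
  show ?thesis
  proof
    assume "e \<in> X"
    have "(a, b) \<in> ?R\<^sup>*" if ab: "(a, b) \<in> E - F" for a b
    proof (cases "(a, b) = e")
      case True
      have "b < n" using ab E by auto
      \<comment> \<open>Both arcs touch the copy \<open>b + n\<close>, whereas all failed arcs join
        vertices below \<open>n\<close>.\<close>
      then have "(a, b + n) \<in> ?R" "(b + n, b) \<in> ?R"
        using True \<open>e \<in> X\<close> E F(1) e by (auto simp: detour_digraph_def)
      then show ?thesis by (meson converse_rtrancl_into_rtrancl r_into_rtrancl)
    next
      case False
      then show ?thesis using ab by (auto simp: detour_digraph_def)
    qed
    then have "(E - F)\<^sup>* \<subseteq> ?R\<^sup>*" by (intro rtrancl_subset_rtrancl subrelI)
    then show "reachable_avoiding ?D (insert e F) s t" using crit(1) iff by auto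
  next
    assume "reachable_avoiding ?D (insert e F) s t"
    then have st: "(s, t) \<in> ?R\<^sup>*" using iff by simp
    show "e \<in> X"
    proof (rule ccontr)
      assume "e \<notin> X"
      \<comment> \<open>Identifying each copy with its original vertex maps walks of the detour digraph to \<open>E\<close>.\<close>
      define \<pi> where "\<pi> v = (if v < n then v else v - n)" for v
      have walk_map: "(\<pi> a, \<pi> b) \<in> (E - insert e F)\<^sup>*" if ab: "(a, b) \<in> ?R" for a b
      proof -
        consider "(a, b) \<in> E" | "b < n" "a = b + n" | v where "(a, v) \<in> X" "b = v + n"
          using ab by (auto simp: detour_digraph_def)
        then show ?thesis
        proof cases
          case 1
          then show ?thesis using ab E by (auto simp: \<pi>_def)
        next
          case 2
          then show ?thesis by (auto simp: \<pi>_def)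
        next
          case 3
          \<comment> \<open>Independence enters here: an arc of \<open>X\<close> is not
            \<open>e\<close>, as \<open>e \<notin> X\<close>, and hence not in \<open>F\<close>, as
            \<open>F \<inter> X \<subseteq> {e}\<close>.\<close>
          then have "(a, v) \<in> E - insert e F" "a < n" "v < n"
            using X F E \<open>e \<notin> X\<close> by auto
          then show ?thesis using 3 by (auto simp: \<pi>_def)
        qed
      qed
      from st have "(\<pi> s, \<pi> t) \<in> (E - insert e F)\<^sup>*"
      proof (induction rule: rtrancl_induct)
        case (step y z)
        then show ?case using walk_map[of y z] rtrancl_trans by metis
      qed simp
      then show False using crit(2) s t by (simp add: \<pi>_def)
    qed
  qed
qed

section \<open>Counting stored bit strings\<close>

text \<open>Only \<open>2 ^ Suc b - 1\<close> bit strings have length at most \<open>b\<close>. The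
  strictness in \<open>2 ^ card Y < 2 ^ Suc b\<close> gives the bound without an additive loss,
  although strings of different lengths are allowed.\<close>

lemma card_le_if_inj_on_bool_lists:
  fixes f :: "'a set \<Rightarrow> bool list"
  assumes "finite Y" "inj_on f (Pow Y)" "\<And>X. X \<subseteq> Y \<Longrightarrow> length (f X) \<le> b"
  shows "card Y \<le> b"
proof -
  let ?L = "{xs :: bool list. set xs \<subseteq> UNIV \<and> length xs \<le> b}"
  have "2 ^ card Y = card (f ` Pow Y)"
    using assms by (simp add: card_image card_Pow)
  also have "\<dots> \<le> card ?L"
    using assms(3) by (intro card_mono finite_lists_length_le) auto
  also have "\<dots> = (\<Sum>i\<le>b. 2 ^ i)"
    by (subst card_lists_length_le) auto
  also have "\<dots> < 2 ^ Suc b"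
    using sum_power2[of "Suc b"] by (simp add: atLeast0LessThan lessThan_Suc_atMost)
  finally have "card Y < Suc b" by (rule power_less_imp_less_exp[rotated]) simp
  then show ?thesis by simp
qed

text \<open>The subset \<open>X\<close> can be read off from the string stored for its detour
  digraph: one query per arc of \<open>Y\<close> decides membership. Hence the strings for different
  \<open>X\<close> differ.\<close>

lemma independent_critical_arcs_le_oracle_size:
  assumes E: "E \<subseteq> {..<n} \<times> {..<n}" and P: "P \<subseteq> {..<n} \<times> {..<n}" "card P = p"
    and Y: "Y \<subseteq> E"
    and crit: "\<And>e. e \<in> Y \<Longrightarrow> \<exists>s t F. (s, t) \<in> P \<and> F \<subseteq> E \<and> F \<inter> Y \<subseteq> {e} \<and> card F < k \<and>
      (s, t) \<in> (E - F)\<^sup>* \<and> (s, t) \<notin> (E - insert e F)\<^sup>*"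
  shows "card Y \<le> ft_oracle_extremal (2 * n) p k"
proof -
  let ?b = "ft_oracle_extremal (2 * n) p k"
  let ?D = "detour_digraph n E"
  have "\<exists>b store query. ft_reachability_oracle (2 * n) p k store query \<and>
      (SUP I \<in> instances (2 * n) p. length (store I)) = b"
    using ft_reachability_oracle_exists by blast
  from LeastI_ex[OF this] obtain store query where
    o: "ft_reachability_oracle (2 * n) p k store query" and
    b: "(SUP I \<in> instances (2 * n) p. length (store I)) = ?b"
    unfolding ft_oracle_extremal_def by blast
  have inst: "(?D X, P) \<in> instances (2 * n) p" if "X \<subseteq> Y" for X
  proof -
    have "{..<n} \<times> {..<n} \<subseteq> {..<2 * n} \<times> {..<2 * n}" by auto
    moreover have "pair_fin_digraph (?D X)"
      using that Y E by (intro pair_fin_digraph_detour) auto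
    ultimately show ?thesis
      using P by (auto simp: instances_def detour_digraph_def)
  qed
  have finE: "finite E" using E finite_subset by blast
  \<comment> \<open>The query is chosen before \<open>X\<close>, so equal stored strings force equal
    answers for two subsets.\<close>
  have decode: "\<exists>q F. \<forall>X \<subseteq> Y. query (store (?D X, P)) q F \<longleftrightarrow> e \<in> X" if e: "e \<in> Y" for e
  proof -
    from crit[OF e] obtain s t F where st: "(s, t) \<in> P" and F: "F \<subseteq> E" "F \<inter> Y \<subseteq> {e}" "card F < k"
      and c: "(s, t) \<in> (E - F)\<^sup>*" "(s, t) \<notin> (E - insert e F)\<^sup>*" by blast
    have "query (store (?D X, P)) (s, t) (insert e F) \<longleftrightarrow> e \<in> X" if X: "X \<subseteq> Y" for X
    proof -
      have "insert e F \<subseteq> parcs (?D X)" using e Y F by (auto simp: detour_digraph_def)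
      \<comment> \<open>The strict bound \<open>card F < k\<close> leaves room for the failure of
        \<open>e\<close>; this is why fault tolerance drops from \<open>k\<close> to
        \<open>k - 1\<close>.\<close>
      moreover have "card (insert e F) \<le> k"
        using F(3) card_insert_le_m1[of k F e] by simp
      ultimately have "query (store (?D X, P)) (s, t) (insert e F) \<longleftrightarrow>
          reachable_avoiding (?D X) (insert e F) s t"
        using bspec[OF o[unfolded ft_reachability_oracle_def] inst[OF X]] st
        by (simp add: answers_def split_beta Ball_def)
      also have "\<dots> \<longleftrightarrow> e \<in> X"
        using E X Y F c st P e by (intro detour_reachable_iff) auto
      finally show ?thesis .
    qed
    then show ?thesis by blast
  qed
  have "inj_on (\<lambda>X. store (?D X, P)) (Pow Y)"
  proof (rule inj_onI)
    fix X X' assume "X \<in> Pow Y" "X' \<in> Pow Y" and eq: "store (?D X, P) = store (?D X', P)"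
    then have "e \<in> X \<longleftrightarrow> e \<in> X'" if "e \<in> Y" for e
      using decode[OF that] by (metis PowD)
    then show "X = X'" using \<open>X \<in> Pow Y\<close> \<open>X' \<in> Pow Y\<close> by blast
  qed
  \<comment> \<open>The supremum is an upper bound because there are only finitely many
    instances.\<close>
  moreover have "length (store (?D X, P)) \<le> ?b" if "X \<subseteq> Y" for X
    unfolding b[symmetric] using inst[OF that] finite_instances
    by (intro cSUP_upper) (auto intro: bdd_above_finite)
  ultimately show ?thesis
    using card_le_if_inj_on_bool_lists finite_subset[OF Y finE] by blast
qed

text \<open>The factor is that of the independent set lemma with out-degree \<open>k - 1\<close>,
  applied to the arcs of a minimum subgraph \<open>H\<close>. The demand set \<open>P\<close> is
  kept on the original vertices, so \<open>p\<close> does not change.\<close>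

lemma min_ft_subgraph_size_le_oracle_size:
  assumes k: "k \<ge> 1" and I: "(G, P) \<in> instances n p"
  shows "min_ft_subgraph_size (k - 1) G P \<le> (2 * (k - 1) + 1) * ft_oracle_extremal (2 * n) p k"
proof -
  have G: "pair_fin_digraph G" "pverts G = {..<n}" and P: "P \<subseteq> {..<n} \<times> {..<n}" "card P = p"
    using I by (auto simp: instances_def)
  have "pair_wf_digraph G" using G(1) by (simp add: pair_fin_digraph_def)
  then have "\<exists>m H. ft_reachability_subgraph (k - 1) G P H \<and> card (parcs H) = m"
    using ft_reachability_subgraph_refl by blast
  from LeastI_ex[OF this] obtain H where H: "ft_reachability_subgraph (k - 1) G P H"
    "card (parcs H) = min_ft_subgraph_size (k - 1) G P"
    unfolding min_ft_subgraph_size_def by blast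
  have "parcs H \<subseteq> parcs G"
    using H(1) by (auto simp: ft_reachability_subgraph_def subgraph_def)
  then have E: "parcs H \<subseteq> {..<n} \<times> {..<n}"
    using pair_wf_digraph.wellformed'[OF \<open>pair_wf_digraph G\<close>] G(2) by fast
  then have finH: "finite (parcs H)" using finite_subset by blast
  define crit where "crit e F \<longleftrightarrow> F \<subseteq> parcs H \<and> card F \<le> k - 1 \<and>
    (\<exists>s t. (s, t) \<in> P \<and> (s, t) \<in> (parcs H - F)\<^sup>* \<and> (s, t) \<notin> (parcs H - insert e F)\<^sup>*)" for e F
  have "\<exists>F. crit e F" if "e \<in> parcs H" for e
    using minimal_ft_subgraph_critical_arc[OF G(1) H that] unfolding crit_def by metis
  then obtain f where f: "\<And>e. e \<in> parcs H \<Longrightarrow> crit e (f e)" by metis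
  then have "finite (f e)" "card (f e) \<le> k - 1" if "e \<in> parcs H" for e
    using that finite_subset[OF _ finH] unfolding crit_def by blast+
  with exists_independent_subset[OF finH, of f "k - 1"] obtain Y where
    Y: "Y \<subseteq> parcs H" "\<forall>e \<in> Y. f e \<inter> Y \<subseteq> {e}" "card (parcs H) \<le> (2 * (k - 1) + 1) * card Y"
    by blast
  have "card Y \<le> ft_oracle_extremal (2 * n) p k"
  proof (rule independent_critical_arcs_le_oracle_size[OF E P Y(1)])
    fix e assume "e \<in> Y"
    then have c: "crit e (f e)" using f Y(1) by blast
    \<comment> \<open>Needs \<open>k \<ge> 1\<close>, since subtraction on naturals is truncated at
      0.\<close>
    then have "card (f e) < k" using k by (auto simp: crit_def)
    then show "\<exists>s t F. (s, t) \<in> P \<and> F \<subseteq> parcs H \<and> F \<inter> Y \<subseteq> {e} \<and> card F < k \<and>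
      (s, t) \<in> (parcs H - F)\<^sup>* \<and> (s, t) \<notin> (parcs H - insert e F)\<^sup>*"
      using c Y(2) \<open>e \<in> Y\<close> unfolding crit_def by blast
  qed
  then have "(2 * (k - 1) + 1) * card Y \<le> (2 * (k - 1) + 1) * ft_oracle_extremal (2 * n) p k"
    by (rule mult_le_mono2)
  then show ?thesis using Y(3) H(2) by linarith
qed

theorem theorem8p5:
  shows "\<exists>c::real. c > 0 \<and> (\<forall>n k p :: nat. n \<ge> 1 \<longrightarrow> k \<ge> 1 \<longrightarrow>
           real (ft_oracle_extremal (2 * n) p k) \<ge>
             c * (real (ft_subgraph_extremal n p (k - 1)) / real k))"
proof (intro exI[of _ "1/2"] conjI allI impI)
  fix n k p :: nat assume k: "k \<ge> 1"
  let ?b = "ft_oracle_extremal (2 * n) p k"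
  have "ft_subgraph_extremal n p (k - 1) \<le> (2 * (k - 1) + 1) * ?b"
  \<comment> \<open>Without instances, that is for \<open>p\<close> too large, the supremum is 0 by
    convention; bounding it elementwise requires a nonempty set.\<close>
  proof (cases "instances n p = {}")
    case False
    then show ?thesis
      unfolding ft_subgraph_extremal_def
      using min_ft_subgraph_size_le_oracle_size[OF k] by (intro cSUP_least) auto
  qed (simp add: ft_subgraph_extremal_def)
  \<comment> \<open>Rounding \<open>2 * (k - 1) + 1\<close> up to \<open>2 * k\<close> yields the
    constant \<open>1/2\<close>.\<close>
  also have "\<dots> \<le> (2 * k) * ?b" using k by (intro mult_le_mono1) linarith
  finally have "real (ft_subgraph_extremal n p (k - 1)) \<le> real ((2 * k) * ?b)"
    by (rule of_nat_mono)
  then show "1 / 2 * (real (ft_subgraph_extremal n p (k - 1)) / real k) \<le> real ?b"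
    using k by (simp add: field_simps)
qed simp

end
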